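(* (Generalized BEST Theorem.) Let $G$ be a graph, $\alpha$ a flow on $G$, and $w\in V(G)$. Then $$|\mathcal{C}_G(\alpha,\Vert\alpha\Vert)|=\Vert\alpha\Vert\cdot \mathrm{ec}(\widetilde{D}_\alpha)\cdot\prod_{\mathbf{e}\in\mathbf{E}_{\mathfrak{o}(\alpha)}(G)}\big(\deg_\alpha(\mathbf{e})!\big)^{-1} =\Vert\alpha\Vert\cdot\det\big(L_\alpha^{\mathrm{red}(w)}(G)\big)\cdot\prod_{v\in V(G)}(\deg^+_\alpha(v)-1)!\cdot\prod_{\mathbf{e}\in\mathbf{E}_{\mathfrak{o}(\alpha)}(G)}\big(\deg_\alpha(\mathbf{e})!\big)^{-1}.$$
   Context: A graph is finite, may have loops and multiple edges, and has no isolated vertices. Each edge $e$ gives two oriented edges $\mathbf{e},\mathbf{e}^{-1}$ with initial/terminal vertices $\mathbf{e}(0),\mathbf{e}(1)$; $\mathbf{E}(G)$ is the set of oriented edges. An orientation $\mathfrak{o}$ chooses one oriented edge per edge, giving $\mathbf{E}_{\mathfrak{o}}(G)$. A walk of length $l$ is $\mathbf{a}_1\cdots\mathbf{a}_l$ with $\mathbf{a}_{i+1}(0)=\mathbf{a}_i(1)$; a circuit is a closed walk with no backtrack ($\mathbf{a}_{i+1}\ne\mathbf{a}_i^{-1}$) and no tail ($\mathbf{a}_1\neq\mathbf{a}_l^{-1}$). $C_1(G,\mathbb{Z})$ is the free abelian group on $\mathbf{E}_{\mathfrak{o}}(G)$ with $\mathbf{e}^{-1}=-\mathbf{e}$; for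 $\alpha=\sum c_{\mathbf{e}}\mathbf{e}$, $\deg_\alpha(\mathbf{e})=c_{\mathbf{e}}$, $\deg_\alpha(\mathbf{e}^{-1})=-c_{\mathbf{e}}$, $\deg_\alpha(v)=\sum_{\mathbf{e}(0)=v}\deg_\alpha(\mathbf{e})$ (sum over $\mathbf{E}(G)$), $H_1(G,\mathbb{Z})=\{\alpha:\deg_\alpha(v)=0\ \forall v\}$, $\Vert\alpha\Vert=\sum_{\mathbf{e}\in\mathbf{E}_{\mathfrak{o}}(G)}|c_{\mathbf{e}}|$. The abelianization of a walk is the sum of its oriented edges; $\mathcal{C}_G(\alpha,l)$ is the set of circuits of length $l$ with abelianization $\alpha$. A flow on $G$ is $\alpha\in H_1(G,\mathbb{Z})$ with $\deg_\alpha(\mathbf{e})\neq0$ for all oriented edges; then $\alpha=\sum_{\mathbf{e}\in\mathbf{E}_{\mathfrak{o}(\alpha)}(G)}c_{\mathbf{e}}\mathbf{e}$ with all $c_{\mathbf{e}}>0$ for a unique orientation $\mathfrak{o}(\alpha)$. $\deg^+_\alpha(v)=\sum_{\mathbf{e}\in\mathbf{E}_{\mathfrak{o}(\alpha)}(G),\mathbf{e}(0)=v}c_{\mathbf{e}}$. The lift $\widetilde{D}_\alpha$ is the digraph on $V(G)$ obtained by replacing each edge $e$ (oriented as $\mathbf{e}\in\mathbf{E}_{\mathfrak{o}(\alpha)}(G)$) by $c_{\mathbf{e}}$ parallel arcs all oriented as $\mathbf{e}$. For a digraph $D$, an Eulerian circuit is a closed directed walk using each arc exactly once, and $\mathrm{ec}(D)$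 is the number of Eulerian cycles, i.e. Eulerian circuits modulo cyclic rotation. The weighted Laplacian $L_\alpha(G)$ (rows/columns indexed by $V(G)=\{v_1,\dots,v_n\}$) has $(L_\alpha(G))_{ij}=-\sum_{\mathbf{e}\in\mathbf{E}_{\mathfrak{o}(\alpha)}(G),\mathbf{e}(0)=v_i,\mathbf{e}(1)=v_j}c_{\mathbf{e}}$ for $i\ne j$ and $(L_\alpha(G))_{ii}=\sum_{\mathbf{e}\in\mathbf{E}_{\mathfrak{o}(\alpha)}(G),\mathbf{e}(0)=v_i,\mathbf{e}(1)\ne v_i}c_{\mathbf{e}}$; $L_\alpha^{\mathrm{red}(w)}(G)$ is obtained by deleting the row and column of $w$. *)

theory Defs
  imports
    "Graph_Theory.Graph_Theory"
    "Jordan_Normal_Form.Determinant"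
    "HOL-Algebra.Free_Abelian_Groups"
begin

text \<open>
  A finite undirected graph, possibly with loops and multiple edges, is represented by its oriented
  edges: \<open>arcs G\<close> is the set of all oriented edges, \<open>tail\<close> and \<open>head\<close> are their initial and
  terminal vertices, and \<open>arev\<close> is the inversion of oriented edges, which has no fixed points on
  \<open>arcs G\<close>. An undirected edge is a pair \<open>{e, arev e}\<close>; a loop also gives two oriented edges.
\<close>

locale multigraph = fin_digraph G + bidirected_digraph G arev
  for G :: "('a, 'b) pre_digraph" and arev :: "'b \<Rightarrow> 'b" +
  assumes no_isolated: "v \<in> verts G \<Longrightarrow> \<exists>e \<in> arcs G. tail G e = v \<or> head G e = v"

definition orientation :: "('a, 'b) pre_digraph \<Rightarrow> ('b \<Rightarrow> 'b) \<Rightarrow> 'b set \<Rightarrow> bool" where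
  "orientation G arev O1 \<longleftrightarrow> O1 \<subseteq> arcs G \<and> (\<forall>e \<in> arcs G. (e \<in> O1) \<noteq> (arev e \<in> O1))"

text \<open>
  The group of 1-chains is \<open>free_Abelian_group O1\<close> for a reference orientation \<open>O1\<close>. The chain of
  an oriented edge outside \<open>O1\<close> is minus that of its inverse.
\<close>

definition chain_of :: "('b \<Rightarrow> 'b) \<Rightarrow> 'b set \<Rightarrow> 'b \<Rightarrow> ('b \<Rightarrow>\<^sub>0 int)" where
  "chain_of arev O1 e = (if e \<in> O1 then frag_of e else - frag_of (arev e))"

definition deg :: "('b \<Rightarrow> 'b) \<Rightarrow> 'b set \<Rightarrow> ('b \<Rightarrow>\<^sub>0 int) \<Rightarrow> 'b \<Rightarrow> int" where
  "deg arev O1 \<alpha> e =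
     (if e \<in> O1 then Poly_Mapping.lookup \<alpha> e else - Poly_Mapping.lookup \<alpha> (arev e))"

definition vdeg ::
  "('a, 'b) pre_digraph \<Rightarrow> ('b \<Rightarrow> 'b) \<Rightarrow> 'b set \<Rightarrow> ('b \<Rightarrow>\<^sub>0 int) \<Rightarrow> 'a \<Rightarrow> int" where
  "vdeg G arev O1 \<alpha> v = (\<Sum>e | e \<in> arcs G \<and> tail G e = v. deg arev O1 \<alpha> e)"

definition H1 :: "('a, 'b) pre_digraph \<Rightarrow> ('b \<Rightarrow> 'b) \<Rightarrow> 'b set \<Rightarrow> ('b \<Rightarrow>\<^sub>0 int) set" where
  "H1 G arev O1 =
     {\<alpha> \<in> carrier (free_Abelian_group O1). \<forall>v \<in> verts G. vdeg G arev O1 \<alpha> v = 0}"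

definition chain_norm :: "'b set \<Rightarrow> ('b \<Rightarrow>\<^sub>0 int) \<Rightarrow> nat" where
  "chain_norm O1 \<alpha> = (\<Sum>e \<in> O1. nat \<bar>Poly_Mapping.lookup \<alpha> e\<bar>)"

definition flow ::
  "('a, 'b) pre_digraph \<Rightarrow> ('b \<Rightarrow> 'b) \<Rightarrow> 'b set \<Rightarrow> ('b \<Rightarrow>\<^sub>0 int) \<Rightarrow> bool" where
  "flow G arev O1 \<alpha> \<longleftrightarrow> \<alpha> \<in> H1 G arev O1 \<and> (\<forall>e \<in> arcs G. deg arev O1 \<alpha> e \<noteq> 0)"

definition abelianization :: "('b \<Rightarrow> 'b) \<Rightarrow> 'b set \<Rightarrow> 'b list \<Rightarrow> ('b \<Rightarrow>\<^sub>0 int)" where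
  "abelianization arev O1 p = sum_list (map (chain_of arev O1) p)"

text \<open>Circuits are based: cyclic rotations of a circuit are counted as different circuits.\<close>

definition circuit :: "('a, 'b) pre_digraph \<Rightarrow> ('b \<Rightarrow> 'b) \<Rightarrow> 'b list \<Rightarrow> bool" where
  "circuit G arev p \<longleftrightarrow>
     p \<noteq> [] \<and> (\<exists>u. pre_digraph.awalk G u p u) \<and>
     (\<forall>i. Suc i < length p \<longrightarrow> p ! Suc i \<noteq> arev (p ! i)) \<and>
     hd p \<noteq> arev (last p)"

definition circuits ::
  "('a, 'b) pre_digraph \<Rightarrow> ('b \<Rightarrow> 'b) \<Rightarrow> 'b set \<Rightarrow> ('b \<Rightarrow>\<^sub>0 int) \<Rightarrow> nat \<Rightarrow> 'b list set" where
  "circuits G arev O1 \<alpha> l =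
     {p. circuit G arev p \<and> length p = l \<and> abelianization arev O1 p = \<alpha>}"

definition flow_orientation ::
  "('a, 'b) pre_digraph \<Rightarrow> ('b \<Rightarrow> 'b) \<Rightarrow> 'b set \<Rightarrow> ('b \<Rightarrow>\<^sub>0 int) \<Rightarrow> 'b set" where
  "flow_orientation G arev O1 \<alpha> = {e \<in> arcs G. deg arev O1 \<alpha> e > 0}"

text \<open>
  For a flow every vertex has \<open>outdeg \<ge> 1\<close>, as no vertex is isolated; so \<open>outdeg - 1\<close> on \<open>nat\<close>
  does not truncate.
\<close>

definition outdeg ::
  "('a, 'b) pre_digraph \<Rightarrow> ('b \<Rightarrow> 'b) \<Rightarrow> 'b set \<Rightarrow> ('b \<Rightarrow>\<^sub>0 int) \<Rightarrow> 'a \<Rightarrow> nat" where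
  "outdeg G arev O1 \<alpha> v =
     (\<Sum>e | e \<in> flow_orientation G arev O1 \<alpha> \<and> tail G e = v. nat (deg arev O1 \<alpha> e))"

definition lift ::
  "('a, 'b) pre_digraph \<Rightarrow> ('b \<Rightarrow> 'b) \<Rightarrow> 'b set \<Rightarrow> ('b \<Rightarrow>\<^sub>0 int) \<Rightarrow> ('a, 'b \<times> nat) pre_digraph" where
  "lift G arev O1 \<alpha> =
     \<lparr> verts = verts G,
       arcs = (SIGMA e : flow_orientation G arev O1 \<alpha>. {..<nat (deg arev O1 \<alpha> e)}),
       tail = tail G \<circ> fst,
       head = head G \<circ> fst \<rparr>"

text \<open>
  Unlike \<open>pre_digraph.euler_trail\<close>, no condition is imposed on the visited vertices.
\<close>

definition eulerian_circuits :: "('a, 'b) pre_digraph \<Rightarrow> 'b list set" where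
  "eulerian_circuits D = {p. \<exists>u. pre_digraph.trail D u p u \<and> set p = arcs D}"

definition eulerian_rotation :: "('a, 'b) pre_digraph \<Rightarrow> ('b list \<times> 'b list) set" where
  "eulerian_rotation D =
     {(p, q). p \<in> eulerian_circuits D \<and> q \<in> eulerian_circuits D \<and> (\<exists>n. q = rotate n p)}"

definition ec :: "('a, 'b) pre_digraph \<Rightarrow> nat" where
  "ec D = card (eulerian_circuits D // eulerian_rotation D)"

text \<open>The list \<open>vs\<close> is an enumeration of the vertices, which indexes rows and columns.\<close>

definition laplacian ::
  "('a, 'b) pre_digraph \<Rightarrow> ('b \<Rightarrow> 'b) \<Rightarrow> 'b set \<Rightarrow> ('b \<Rightarrow>\<^sub>0 int) \<Rightarrow> 'a list \<Rightarrow> int mat" where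
  "laplacian G arev O1 \<alpha> vs = mat (length vs) (length vs) (\<lambda>(i, j).
     if i = j
     then (\<Sum>e | e \<in> flow_orientation G arev O1 \<alpha> \<and> tail G e = vs ! i \<and> head G e \<noteq> vs ! i.
             deg arev O1 \<alpha> e)
     else - (\<Sum>e | e \<in> flow_orientation G arev O1 \<alpha> \<and> tail G e = vs ! i \<and> head G e = vs ! j.
               deg arev O1 \<alpha> e))"

context multigraph
begin

lemma orientation_arev_iff:
  assumes "orientation G arev P" "e \<in> arcs G"
  shows "arev e \<in> P \<longleftrightarrow> e \<notin> P"
  using assms unfolding orientation_def by blast

lemma orientation_subset:
  assumes "orientation G arev P"
  shows "P \<subseteq> arcs G"
  using assms unfolding orientation_def by blast

lemma deg_arev:
  assumes "orientation G arev O1" "e \<in> arcs G"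
  shows "deg arev O1 \<alpha> (arev e) = - deg arev O1 \<alpha> e"
  using orientation_arev_iff[OF assms] by (simp add: deg_def)

lemma deg_chain_of:
  assumes O1: "orientation G arev O1" and e: "e \<in> arcs G" and x: "x \<in> arcs G"
  shows "deg arev O1 (chain_of arev O1 e) x = (if x = e then 1 else if x = arev e then -1 else 0)"
proof -
  consider "x = e" | "x = arev e" "x \<noteq> e" | "x \<noteq> e" "x \<noteq> arev e" by blast
  then show ?thesis
  proof cases
    case 1
    have "arev e \<noteq> e" using e by (rule arev_neq)
    then show ?thesis using 1 by (simp add: deg_def chain_of_def)
  next
    case 2
    then show ?thesis
      using orientation_arev_iff[OF O1 e] by (cases "e \<in> O1") (simp_all add: deg_def chain_of_def)
  next
    case 3
    have "arev x \<noteq> e" "arev x \<noteq> arev e" using 3 by (metis arev_arev)+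
    then show ?thesis using 3 by (simp add: deg_def chain_of_def)
  qed
qed

lemma deg_sum:
  "deg arev O1 (\<Sum>e\<in>P. frag_cmul (c e) (f e)) x = (\<Sum>e\<in>P. c e * deg arev O1 (f e) x)"
  by (auto simp: deg_def lookup_sum sum_negf)

lemma deg_expansion:
  assumes O1: "orientation G arev O1" and P: "orientation G arev P" and x: "x \<in> P"
  shows "deg arev O1 (\<Sum>e\<in>P. frag_cmul (c e) (chain_of arev O1 e)) x = c x"
proof -
  have sub: "P \<subseteq> arcs G" using P by (rule orientation_subset)
  have fin: "finite P" using sub finite_arcs finite_subset by blast
  have "c e * deg arev O1 (chain_of arev O1 e) x = (if e = x then c x else 0)" if "e \<in> P" for e
  proof -
    have "x \<noteq> arev e" using orientation_arev_iff[OF P] that x sub by auto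
    then show ?thesis using deg_chain_of[OF O1] sub that x by (auto simp: subset_iff)
  qed
  then have "(\<Sum>e\<in>P. c e * deg arev O1 (chain_of arev O1 e) x) = (\<Sum>e\<in>P. if e = x then c x else 0)"
    by (rule sum.cong[OF refl])
  then show ?thesis using fin x by (simp add: deg_sum)
qed

lemma keys_expansion:
  assumes O1: "orientation G arev O1" and P: "orientation G arev P"
  shows "Poly_Mapping.keys (\<Sum>e\<in>P. frag_cmul (c e) (chain_of arev O1 e)) \<subseteq> O1"
proof -
  have "Poly_Mapping.keys (frag_cmul (c e) (chain_of arev O1 e)) \<subseteq> O1" if "e \<in> P" for e
  proof -
    have "e \<in> arcs G" using that orientation_subset[OF P] by blast
    then have "e \<in> O1 \<or> arev e \<in> O1" using orientation_arev_iff[OF O1] by blast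
    then have "Poly_Mapping.keys (chain_of arev O1 e) \<subseteq> O1"
      by (cases "e \<in> O1") (simp_all add: chain_of_def)
    then show ?thesis using keys_cmul by (rule subset_trans[rotated])
  qed
  then show ?thesis using keys_sum[of "\<lambda>e. frag_cmul (c e) (chain_of arev O1 e)" P] by blast
qed

lemma chain_eqI:
  assumes "orientation G arev O1" "orientation G arev P"
    and "Poly_Mapping.keys \<alpha> \<subseteq> O1" "Poly_Mapping.keys \<beta> \<subseteq> O1"
    and "\<And>x. x \<in> P \<Longrightarrow> deg arev O1 \<alpha> x = deg arev O1 \<beta> x"
  shows "\<alpha> = \<beta>"
proof (rule poly_mapping_eqI)
  fix x
  show "Poly_Mapping.lookup \<alpha> x = Poly_Mapping.lookup \<beta> x"
  proof (cases "x \<in> O1")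
    case True
    then have x: "x \<in> arcs G" using orientation_subset[OF assms(1)] by blast
    have "deg arev O1 \<alpha> x = deg arev O1 \<beta> x"
    proof (cases "x \<in> P")
      case False
      then have "arev x \<in> P" using orientation_arev_iff[OF assms(2) x] by blast
      then have "deg arev O1 \<alpha> (arev x) = deg arev O1 \<beta> (arev x)" by (rule assms(5))
      then show ?thesis by (simp add: deg_arev[OF assms(1) x])
    qed (rule assms(5))
    then show ?thesis using True by (simp add: deg_def)
  next
    case False
    then show ?thesis using assms(3,4) by (metis in_keys_iff subset_iff)
  qed
qed

text \<open>
  \<^const>\<open>flow_orientation\<close> is the unique orientation with respect to which all coefficients of the
  flow are positive, and these coefficients are the degrees.
\<close>

lemma flow_orientation_unique:
  assumes O1: "orientation G arev O1" and \<alpha>: "flow G arev O1 \<alpha>"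
  shows "(orientation G arev P \<and> (\<forall>e\<in>P. c e > 0) \<and>
            \<alpha> = (\<Sum>e\<in>P. frag_cmul (c e) (chain_of arev O1 e))) \<longleftrightarrow>
         P = flow_orientation G arev O1 \<alpha> \<and> (\<forall>e\<in>P. c e = deg arev O1 \<alpha> e)"
    (is "?L \<longleftrightarrow> ?R")
proof
  assume L: ?L
  then have P: "orientation G arev P" and pos: "\<And>e. e \<in> P \<Longrightarrow> c e > 0"
    and eq: "\<alpha> = (\<Sum>e\<in>P. frag_cmul (c e) (chain_of arev O1 e))" by auto
  have d: "deg arev O1 \<alpha> x = c x" if "x \<in> P" for x
    using deg_expansion[OF O1 P that] eq by simp
  have "e \<in> P \<longleftrightarrow> deg arev O1 \<alpha> e > 0" if e: "e \<in> arcs G" for e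
  proof (cases "e \<in> P")
    case True then show ?thesis using d pos by simp
  next
    case False
    then have "arev e \<in> P" using orientation_arev_iff[OF P e] by blast
    then have "deg arev O1 \<alpha> (arev e) > 0" using d pos by simp
    then show ?thesis using False deg_arev[OF O1 e] by simp
  qed
  then show ?R using d orientation_subset[OF P] by (auto simp: flow_orientation_def)
next
  assume R: ?R
  have P: "orientation G arev P"
    unfolding orientation_def
  proof (intro conjI ballI)
    show "P \<subseteq> arcs G" using R by (auto simp: flow_orientation_def)
    fix e assume e: "e \<in> arcs G"
    then have "deg arev O1 \<alpha> e \<noteq> 0" using \<alpha> by (simp add: flow_def)
    then show "(e \<in> P) \<noteq> (arev e \<in> P)"
      using R e deg_arev[OF O1 e, of \<alpha>] by (auto simp: flow_orientation_def)
  qed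
  have "Poly_Mapping.keys \<alpha> \<subseteq> O1"
    using \<alpha> by (simp add: flow_def H1_def free_Abelian_group_def)
  then have "\<alpha> = (\<Sum>e\<in>P. frag_cmul (c e) (chain_of arev O1 e))"
  proof (rule chain_eqI[OF O1 P _ keys_expansion[OF O1 P]])
    fix x assume "x \<in> P"
    then show "deg arev O1 \<alpha> x = deg arev O1 (\<Sum>e\<in>P. frag_cmul (c e) (chain_of arev O1 e)) x"
      using R deg_expansion[OF O1 P \<open>x \<in> P\<close>, of c] by metis
  qed
  moreover have "\<forall>e\<in>P. c e > 0" using R by (auto simp: flow_orientation_def)
  ultimately show ?L using P by blast
qed

end

end

(*
  Eulerian trails from v to the root w that use every arc of B are counted by removing the first arc
  f, which leads out of v. If M is the Laplacian of B with the row of w replaced by a unit row, then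
  the rows of v contributed by the single arcs add up to the row of v in M, so multilinearity gives
  sum_f det M(B - f) = (d - 1) det M(B), where d is the outdegree of v in B. This is also the
  recursion of the factorial (d - 1)!, so the number of trails is
  det M(B) * d(w)! * prod_{x /= w} (d(x) - 1)!, and neither spanning trees nor the matrix-tree
  theorem are needed. Fixing the first arc of an Eulerian circuit of the lift gives ec.

  A circuit with abelianization \<alpha> and length ||\<alpha>|| traverses each edge exactly c_e times along
  the flow; it lifts to prod c_e! Eulerian circuits of the lift, one for every labelling of the
  traversals of each edge by its parallel arcs.
*)
theory Submission
  imports Defs
begin

section \<open>Determinants with unit rows or columns\<close>

text \<open>Deleting row \<open>i\<close> removes every entry in which the two matrices may differ.
  This compares matrices that agree off one row, both when an arc is removed and when the root row
  is exchanged.\<close>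

lemma cofactor_cong:
  assumes A: "A \<in> carrier_mat n n" "A' \<in> carrier_mat n n" and i: "i < n" "j < n"
    and eq: "\<And>i' j'. i' < n \<Longrightarrow> j' < n \<Longrightarrow> i' \<noteq> i \<Longrightarrow> A $$ (i', j') = A' $$ (i', j')"
  shows "cofactor A i j = cofactor A' i j"
proof -
  have "mat_delete A i j = mat_delete A' i j"
    using A i unfolding mat_delete_def by (intro eq_matI) (auto intro!: eq)
  then show ?thesis by (simp add: cofactor_def)
qed

lemma det_unit_row:
  assumes A: "(A :: 'a :: comm_ring_1 mat) \<in> carrier_mat n n" and i: "i < n"
    and eq: "\<And>j. j < n \<Longrightarrow> A $$ (i, j) = of_bool (i = j)"
  shows "det A = cofactor A i i"
proof -
  have "det A = (\<Sum>j<n. A $$ (i, j) * cofactor A i j)" by (rule laplace_expansion_row[OF A i])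
  also have "\<dots> = (\<Sum>j<n. if j = i then cofactor A i i else 0)"
    by (rule sum.cong) (auto simp: eq)
  finally show ?thesis using i by simp
qed

lemma det_unit_column:
  assumes A: "(A :: 'a :: comm_ring_1 mat) \<in> carrier_mat n n" and i: "j < n"
    and eq: "\<And>i. i < n \<Longrightarrow> A $$ (i, j) = of_bool (i = j)"
  shows "det A = cofactor A j j"
proof -
  have "det A = (\<Sum>i<n. A $$ (i, j) * cofactor A i j)" by (rule laplace_expansion_column[OF A i])
  also have "\<dots> = (\<Sum>i<n. if i = j then cofactor A j j else 0)"
    by (rule sum.cong) (auto simp: eq)
  finally show ?thesis using i by simp
qed

section \<open>Counting Eulerian trails\<close>

locale rooted_digraph = fin_digraph D for D :: "('a, 'b) pre_digraph" +
  fixes vs :: "'a list" and k :: nat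
  assumes distinct_vs: "distinct vs" and set_vs: "set vs = verts D" and k_less: "k < length vs"
begin

abbreviation root :: 'a where "root \<equiv> vs ! k"

definition trails :: "'a \<Rightarrow> 'b set \<Rightarrow> 'b list set" where
  "trails v B = {p. cas v p root \<and> distinct p \<and> set p = B}"

definition out_arcs_in :: "'b set \<Rightarrow> 'a \<Rightarrow> 'b set" where
  "out_arcs_in B x = {f \<in> B. tail D f = x}"

definition in_arcs_in :: "'b set \<Rightarrow> 'a \<Rightarrow> 'b set" where
  "in_arcs_in B x = {f \<in> B. head D f = x}"

text \<open>
  The unit rows at the root and at exhausted vertices keep the size of the matrix fixed while arcs
  are removed one after the other.
\<close>

definition unit_laplacian :: "'b set \<Rightarrow> int mat" where
  "unit_laplacian B = mat (length vs) (length vs) (\<lambda>(i, j).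
     if i = k \<or> out_arcs_in B (vs ! i) = {} then of_bool (i = j)
     else of_bool (i = j) * int (card (out_arcs_in B (vs ! i)))
          - int (card (out_arcs_in B (vs ! i) \<inter> in_arcs_in B (vs ! j))))"

text \<open>The root is left out because it contributes d! instead of (d - 1)!. At an exhausted
  vertex \<open>0 - 1 = 0\<close> on \<open>nat\<close>, so its factor is 1.\<close>

definition weight :: "'b set \<Rightarrow> nat" where
  "weight B = (\<Prod>x \<in> verts D - {root}. fact (card (out_arcs_in B x) - 1))"

text \<open>The degree condition for a trail from \<open>v\<close> to the root: outdegree minus
  indegree is 1 at \<open>v\<close>, -1 at the root and 0 elsewhere, or 0 everywhere if
  \<open>v\<close> is the root. The additive form avoids subtraction on \<open>nat\<close>.\<close>

definition balanced :: "'a \<Rightarrow> 'b set \<Rightarrow> bool" where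
  "balanced v B \<longleftrightarrow> (\<forall>x. card (out_arcs_in B x) + of_bool (x = root)
                        = card (in_arcs_in B x) + of_bool (x = v))"

lemma nth_vs_eq_iff [simp]: "i < length vs \<Longrightarrow> j < length vs \<Longrightarrow> vs ! i = vs ! j \<longleftrightarrow> i = j"
  using distinct_vs by (simp add: nth_eq_iff_index_eq)

lemma unit_laplacian_carrier [simp]: "unit_laplacian B \<in> carrier_mat (length vs) (length vs)"
  by (simp add: unit_laplacian_def)

lemma finite_out_arcs_in [simp]: "finite B \<Longrightarrow> finite (out_arcs_in B x)"
  by (simp add: out_arcs_in_def)

lemma finite_in_arcs_in [simp]: "finite B \<Longrightarrow> finite (in_arcs_in B x)"
  by (simp add: in_arcs_in_def)

lemma out_arcs_in_Diff:
  "out_arcs_in (B - {f}) x = (if x = tail D f then out_arcs_in B x - {f} else out_arcs_in B x)"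
  by (auto simp: out_arcs_in_def)

lemma in_arcs_in_Diff:
  "in_arcs_in (B - {f}) x = (if x = head D f then in_arcs_in B x - {f} else in_arcs_in B x)"
  by (auto simp: in_arcs_in_def)

section \<open>The first-arc recursion for trails and its determinant counterpart\<close>

lemma finite_trails: "finite B \<Longrightarrow> finite (trails v B)"
  by (rule finite_subset[OF _ finite_lists_length_eq[of B "card B"]])
     (auto simp: trails_def distinct_card)

text \<open>Trails are sorted by their first arc, which exists because \<open>B\<close> is nonempty
  and every arc of \<open>B\<close> must be used.\<close>

lemma card_trails_rec:
  assumes "finite B" "B \<noteq> {}"
  shows "card (trails v B) = (\<Sum>f \<in> out_arcs_in B v. card (trails (head D f) (B - {f})))"
proof -
  have eq: "trails v B = (\<Union>f \<in> out_arcs_in B v. (#) f ` trails (head D f) (B - {f}))" (is "_ = ?R")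
  proof (intro equalityI subsetI)
    fix p assume "p \<in> trails v B"
    then show "p \<in> ?R"
      using assms(2) by (cases p) (auto simp: trails_def out_arcs_in_def)
  next
    fix p assume "p \<in> ?R"
    then obtain f q where "f \<in> B" "tail D f = v" "p = f # q" "q \<in> trails (head D f) (B - {f})"
      unfolding out_arcs_in_def by blast
    then show "p \<in> trails v B" by (simp add: trails_def insert_absorb)
  qed
  have "card ?R = (\<Sum>f \<in> out_arcs_in B v. card ((#) f ` trails (head D f) (B - {f})))"
  proof (rule card_UN_disjoint)
    show "finite (out_arcs_in B v)" using assms(1) by simp
    show "\<forall>f \<in> out_arcs_in B v. finite ((#) f ` trails (head D f) (B - {f}))"
      using assms(1) by (simp add: finite_trails)
    show "\<forall>f \<in> out_arcs_in B v. \<forall>g \<in> out_arcs_in B v. f \<noteq> g \<longrightarrow>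
       (#) f ` trails (head D f) (B - {f}) \<inter> (#) g ` trails (head D g) (B - {g}) = {}"
      by blast
  qed
  also have "\<dots> = (\<Sum>f \<in> out_arcs_in B v. card (trails (head D f) (B - {f})))"
    by (simp add: card_image)
  finally show ?thesis using eq by simp
qed

text \<open>Removing \<open>f\<close> lowers the outdegree of \<open>v\<close> and the indegree of
  \<open>head D f\<close>, which becomes the new start.\<close>

lemma balanced_Diff:
  assumes "balanced v B" "finite B" "f \<in> out_arcs_in B v"
  shows "balanced (head D f) (B - {f})"
  unfolding balanced_def
proof
  fix x
  have f: "f \<in> B" "tail D f = v" using assms(3) by (auto simp: out_arcs_in_def)
  have o: "card (out_arcs_in B x) = card (out_arcs_in (B - {f}) x) + of_bool (x = v)"
    using f assms(2) card_Suc_Diff1[of "out_arcs_in B x" f]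
    by (auto simp: out_arcs_in_Diff) (auto simp: out_arcs_in_def)
  have i: "card (in_arcs_in B x) = card (in_arcs_in (B - {f}) x) + of_bool (x = head D f)"
    using f assms(2) card_Suc_Diff1[of "in_arcs_in B x" f]
    by (auto simp: in_arcs_in_Diff) (auto simp: in_arcs_in_def)
  show "card (out_arcs_in (B - {f}) x) + of_bool (x = root)
        = card (in_arcs_in (B - {f}) x) + of_bool (x = head D f)"
    using o i assms(1)[unfolded balanced_def, rule_format, of x] by linarith
qed

text \<open>An arc enters only the row of its tail, and the root row is a unit row in any
  case.\<close>

lemma unit_laplacian_Diff_index:
  assumes "i < length vs" "j < length vs" "i = k \<or> vs ! i \<noteq> tail D f"
  shows "unit_laplacian (B - {f}) $$ (i, j) = unit_laplacian B $$ (i, j)"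
proof -
  have "out_arcs_in B (vs ! i) \<inter> in_arcs_in (B - {f}) (vs ! j)
        = out_arcs_in B (vs ! i) \<inter> in_arcs_in B (vs ! j)" if "vs ! i \<noteq> tail D f"
    using that by (auto simp: out_arcs_in_def in_arcs_in_def)
  then show ?thesis using assms by (auto simp: unit_laplacian_def out_arcs_in_Diff)
qed

text \<open>Each arc contributes to the row of its tail the unit vector of the tail minus that of
  the head. A loop thus contributes zero.\<close>

lemma unit_laplacian_index_sum:
  assumes B: "finite B" and ij: "i < length vs" "j < length vs"
    and i: "i \<noteq> k" "out_arcs_in B (vs ! i) \<noteq> {}"
  shows "unit_laplacian B $$ (i, j)
         = (\<Sum>f \<in> out_arcs_in B (vs ! i). of_bool (i = j) - of_bool (head D f = vs ! j))"
proof -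
  have "out_arcs_in B (vs ! i) \<inter> in_arcs_in B (vs ! j)
        = {f \<in> out_arcs_in B (vs ! i). head D f = vs ! j}"
    by (auto simp: out_arcs_in_def in_arcs_in_def)
  then have "int (card (out_arcs_in B (vs ! i) \<inter> in_arcs_in B (vs ! j)))
      = (\<Sum>f \<in> out_arcs_in B (vs ! i). of_bool (head D f = vs ! j))"
    using B by (simp add: of_bool_def sum.If_cases Int_def)
  then show ?thesis
    using ij i by (simp add: unit_laplacian_def sum_subtractf)
qed

text \<open>Let d be the outdegree of \<open>v\<close>. For d at least 2, each removal subtracts one
  arc's share from row \<open>i\<close>, so the determinants add up to d - 1 times that of
  \<open>B\<close>, and (d - 1) (d - 2)! = (d - 1)!. For d = 1 both factorials are 1 by truncation,
  and the single removal leaves the determinant unchanged.\<close>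

lemma sum_det_Diff:
  assumes B: "finite B" "B \<subseteq> arcs D" and bal: "balanced v B" and i: "i < length vs" "i \<noteq> k"
    and v: "v = vs ! i"
  shows "(\<Sum>f \<in> out_arcs_in B v. det (unit_laplacian (B - {f})) * fact (card (out_arcs_in B v) - 1 - 1))
         = det (unit_laplacian B) * fact (card (out_arcs_in B v) - 1)"
proof -
  let ?n = "length vs" and ?O = "out_arcs_in B v"
  \<comment> \<open>For a vertex \<open>x\<close>, \<open>C x\<close> is the determinant of
    \<open>unit_laplacian B\<close> with row \<open>i\<close> replaced by the unit vector of
    \<open>x\<close>; a row given as a sum over arcs then expands into differences of such
    values.\<close>
  define C where "C x = (\<Sum>j<?n. of_bool (x = vs ! j) * cofactor (unit_laplacian B) i j)" for x
  have "v \<noteq> root" using i k_less v by simp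
  then have dv: "card ?O = Suc (card (in_arcs_in B v))"
    using bal[unfolded balanced_def, rule_format, of v] by simp
  then have ne: "?O \<noteq> {}" by auto
  have finO: "finite ?O" using B by simp
  have cof: "cofactor (unit_laplacian (B - {f})) i j = cofactor (unit_laplacian B) i j"
    if "f \<in> ?O" "j < ?n" for f j
    by (rule cofactor_cong[where n = "?n"])
       (use that i v in \<open>auto intro!: unit_laplacian_Diff_index simp: out_arcs_in_def\<close>)
  \<comment> \<open>Stated for \<open>B'\<close> so that it serves both \<open>B\<close> and
    \<open>B - {f}\<close>: the cofactors along row \<open>i\<close> are the same for the
    two.\<close>
  have expand: "det (unit_laplacian B') = (\<Sum>f \<in> out_arcs_in B' v. C v - C (head D f))"
    if B': "finite B'" "out_arcs_in B' v \<noteq> {}"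
      and c: "\<And>j. j < ?n \<Longrightarrow> cofactor (unit_laplacian B') i j = cofactor (unit_laplacian B) i j" for B'
  proof -
    have "det (unit_laplacian B') = (\<Sum>j<?n. unit_laplacian B' $$ (i, j) * cofactor (unit_laplacian B) i j)"
      using laplace_expansion_row[OF unit_laplacian_carrier i(1)] c by simp
    also have "\<dots> = (\<Sum>j<?n. \<Sum>f \<in> out_arcs_in B' v.
        (of_bool (v = vs ! j) - of_bool (head D f = vs ! j)) * cofactor (unit_laplacian B) i j)"
      using that i v by (intro sum.cong) (simp_all add: unit_laplacian_index_sum sum_distrib_right)
    also have "\<dots> = (\<Sum>f \<in> out_arcs_in B' v. C v - C (head D f))"
      by (subst sum.swap) (simp add: C_def left_diff_distrib sum_subtractf)
    finally show ?thesis .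
  qed
  have det: "det (unit_laplacian B) = (\<Sum>f \<in> ?O. C v - C (head D f))"
    by (rule expand) (use B ne in auto)
  show ?thesis
  proof (cases "card ?O = 1")
    case True
    then obtain f where f: "?O = {f}" by (auto simp: card_1_singleton_iff)
    \<comment> \<open>By balance no arc enters \<open>v\<close>, so column \<open>i\<close> is a
      unit column; once \<open>f\<close> is removed, \<open>v\<close> is exhausted and row
      \<open>i\<close> is a unit row. Both determinants are therefore the same cofactor.\<close>
    have "in_arcs_in B v = {}" using dv True B by simp
    then have "det (unit_laplacian B) = cofactor (unit_laplacian B) i i"
      using i v True by (intro det_unit_column) (auto simp: unit_laplacian_def)
    also have "\<dots> = cofactor (unit_laplacian (B - {f})) i i" using cof[of f i] f i by simp
    also have "\<dots> = det (unit_laplacian (B - {f}))"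
    proof -
      have "f \<in> ?O" using f by simp
      then have "out_arcs_in (B - {f}) (vs ! i) = {}"
        using f v by (auto simp: out_arcs_in_def)
      then have "unit_laplacian (B - {f}) $$ (i, j) = of_bool (i = j)" if "j < ?n" for j
        using that i by (simp add: unit_laplacian_def)
      then show ?thesis by (rule det_unit_row[OF unit_laplacian_carrier i(1), symmetric])
    qed
    finally show ?thesis using f by simp
  next
    case False
    have "det (unit_laplacian (B - {f})) = det (unit_laplacian B) - (C v - C (head D f))"
      if f: "f \<in> ?O" for f
    proof -
      have e: "out_arcs_in (B - {f}) v = ?O - {f}" using f by (auto simp: out_arcs_in_def)
      moreover have "?O - {f} \<noteq> {}" using False f by (auto simp: card_1_singleton_iff)
      ultimately have "det (unit_laplacian (B - {f})) = (\<Sum>f \<in> ?O - {f}. C v - C (head D f))"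
        using expand[of "B - {f}"] cof[OF f] B by simp
      then show ?thesis using det f finO by (simp add: sum_diff1)
    qed
    then have "(\<Sum>f \<in> ?O. det (unit_laplacian (B - {f})))
        = (\<Sum>f \<in> ?O. det (unit_laplacian B) - (C v - C (head D f)))"
      by (rule sum.cong[OF refl])
    also have "\<dots> = int (card ?O) * det (unit_laplacian B) - det (unit_laplacian B)"
      unfolding sum_subtractf[of "\<lambda>f. det (unit_laplacian B)"] det[symmetric] by simp
    finally have sum: "(\<Sum>f \<in> ?O. det (unit_laplacian (B - {f})))
        = int (card ?O) * det (unit_laplacian B) - det (unit_laplacian B)" .
    \<comment> \<open>The outdegree is at least 2 here, so subtracting 1 twice does not
      truncate.\<close>
    obtain m where m: "card ?O = Suc (Suc m)"
      using False dv by (cases "card (in_arcs_in B v)") auto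
    show ?thesis
      unfolding sum_distrib_right[symmetric] sum m by (simp add: algebra_simps)
  qed
qed

text \<open>This covers a start at a root with no arc left to leave by, while other arcs remain. No
  trail exists then, and the factorials are nonzero, so the determinant has to vanish.\<close>

lemma det_unit_laplacian_eq_0:
  assumes B: "B \<subseteq> arcs D" "B \<noteq> {}" and bal: "balanced root B" and w: "out_arcs_in B root = {}"
  shows "det (unit_laplacian B) = 0"
proof -
  let ?n = "length vs"
  have fin: "finite B" using B(1) finite_arcs by (rule finite_subset)
  \<comment> \<open>The arcs in \<open>B\<close> never leave the set of vertices that have an outgoing arc in \<open>B\<close>,
    and this set avoids the root; so its indicator is in the kernel.\<close>
  define x where "x = vec ?n (\<lambda>j. of_bool (out_arcs_in B (vs ! j) \<noteq> {}) :: int)"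
  \<comment> \<open>With start and end at the root, balance means equal in- and outdegree, so an arc
    into a vertex forces one out of it.\<close>
  have hd: "out_arcs_in B (head D f) \<noteq> {}" if "f \<in> B" for f
  proof -
    have "in_arcs_in B (head D f) \<noteq> {}" using that by (auto simp: in_arcs_in_def)
    then have "card (in_arcs_in B (head D f)) > 0" using fin by (simp add: card_gt_0_iff)
    then show ?thesis using bal[unfolded balanced_def, rule_format, of "head D f"] by auto
  qed
  have "unit_laplacian B *\<^sub>v x = 0\<^sub>v ?n"
  proof (rule eq_vecI)
    fix i assume "i < dim_vec (0\<^sub>v ?n :: int vec)"
    then have i: "i < ?n" by simp
    have row: "(unit_laplacian B *\<^sub>v x) $ i = (\<Sum>j<?n. unit_laplacian B $$ (i, j) * x $ j)"
      using i by (simp add: scalar_prod_def x_def unit_laplacian_def lessThan_atLeast0)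
    show "(unit_laplacian B *\<^sub>v x) $ i = 0\<^sub>v ?n $ i"
    proof (cases "i = k \<or> out_arcs_in B (vs ! i) = {}")
      case True
      then have "unit_laplacian B $$ (i, j) * x $ j = 0" if "j < ?n" for j
        using that i w by (auto simp: unit_laplacian_def x_def)
      then have "(\<Sum>j<?n. unit_laplacian B $$ (i, j) * x $ j) = 0"
        by (intro sum.neutral) simp
      then show ?thesis using row i by simp
    next
      case False
      \<comment> \<open>Head and tail of an arc in \<open>B\<close> both carry the value 1 in
        \<open>x\<close>, so the share of the arc in the product is 1 - 1.\<close>
      have "(\<Sum>j<?n. of_bool (head D f = vs ! j) * x $ j) = 1"
        if f: "f \<in> out_arcs_in B (vs ! i)" for f
      proof -
        have fB: "f \<in> B" using f by (simp add: out_arcs_in_def)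
        then have "head D f \<in> set vs" using B set_vs by auto
        then obtain l where l: "l < ?n" "vs ! l = head D f" by (auto simp: in_set_conv_nth)
        have "(\<Sum>j<?n. of_bool (head D f = vs ! j) * x $ j) = (\<Sum>j<?n. if j = l then 1 else 0)"
          using l hd[OF fB] by (intro sum.cong) (auto simp: x_def l(2)[symmetric])
        then show ?thesis using l by simp
      qed
      moreover have "(\<Sum>j<?n. of_bool (i = j) * x $ j) = 1"
      proof -
        have "(\<Sum>j<?n. of_bool (i = j) * x $ j) = (\<Sum>j<?n. if j = i then 1 else 0)"
          using False by (intro sum.cong) (auto simp: x_def)
        then show ?thesis using i by simp
      qed
      ultimately have "(\<Sum>f \<in> out_arcs_in B (vs ! i).
          (\<Sum>j<?n. (of_bool (i = j) - of_bool (head D f = vs ! j)) * x $ j)) = 0"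
        by (simp add: left_diff_distrib sum_subtractf)
      then have "(\<Sum>j<?n. unit_laplacian B $$ (i, j) * x $ j) = 0"
        using i False fin by (subst (asm) sum.swap)
          (simp add: unit_laplacian_index_sum sum_distrib_right)
      then show ?thesis using row i by simp
    qed
  qed (simp add: unit_laplacian_def)
  moreover have "x \<in> carrier_vec ?n" by (simp add: x_def)
  moreover have "x \<noteq> 0\<^sub>v ?n"
  proof -
    obtain f where f: "f \<in> B" using B(2) by blast
    then have "tail D f \<in> set vs" using B set_vs by auto
    then obtain l where l: "l < ?n" "vs ! l = tail D f" by (auto simp: in_set_conv_nth)
    then have "f \<in> out_arcs_in B (vs ! l)" using f by (simp add: out_arcs_in_def)
    then have "x $ l \<noteq> 0\<^sub>v ?n $ l" using l(1) by (auto simp: x_def)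
    then show ?thesis by metis
  qed
  ultimately show ?thesis
    using det_0_iff_vec_prod_zero[OF unit_laplacian_carrier] by blast
qed

text \<open>Induction on the number of remaining arcs. From a start other than the root,
  \<open>sum_det_Diff\<close> sums the recursion. From the root, the matrix and
  \<open>weight\<close> stay the same, and each of the d choices leaves (d - 1)!, which explains the
  factor d! of the root.\<close>

theorem card_trails:
  assumes "B \<subseteq> arcs D" "balanced v B" "v \<in> verts D"
  shows "int (card (trails v B))
         = det (unit_laplacian B) * int (weight B) * fact (card (out_arcs_in B root))"
  using assms
proof (induction "card B" arbitrary: B v rule: less_induct)
  case less
  have fin: "finite B" using less.prems(1) finite_arcs by (rule finite_subset)
  show ?case
  proof (cases "B = {}")
    case True
    \<comment> \<open>All vertices are exhausted, so every row is a unit row; this matches the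
      single empty trail.\<close>
    have "unit_laplacian B = 1\<^sub>m (length vs)"
      by (rule eq_matI) (auto simp: True unit_laplacian_def out_arcs_in_def)
    moreover have "v = root"
      using less.prems(2)[unfolded balanced_def, rule_format, of v]
      by (simp add: True out_arcs_in_def in_arcs_in_def of_bool_def split: if_splits)
    then have "trails v B = {[]}" by (auto simp: trails_def True)
    ultimately show ?thesis by (simp add: weight_def out_arcs_in_def True)
  next
    case False
    have IH: "int (card (trails (head D f) (B - {f})))
       = det (unit_laplacian (B - {f})) * int (weight (B - {f})) * fact (card (out_arcs_in (B - {f}) root))"
      if f: "f \<in> out_arcs_in B v" for f
    proof -
      have fB: "f \<in> B" using f by (simp add: out_arcs_in_def)
      then have "card (B - {f}) < card B" using fin by (rule card_Diff1_less[rotated])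
      then show ?thesis
        using less.hyps[of "B - {f}" "head D f"] balanced_Diff[OF less.prems(2) fin f]
          less.prems(1) fB head_in_verts[of f] by blast
    qed
    have rec: "int (card (trails v B)) = (\<Sum>f \<in> out_arcs_in B v. det (unit_laplacian (B - {f}))
        * int (weight (B - {f})) * fact (card (out_arcs_in (B - {f}) root)))"
      using IH by (simp add: card_trails_rec[OF fin False])
    show ?thesis
    proof (cases "v = root")
      case True
      have "det (unit_laplacian (B - {f})) = det (unit_laplacian B)"
        "weight (B - {f}) = weight B"
        "card (out_arcs_in (B - {f}) root) = card (out_arcs_in B root) - 1"
        if f: "f \<in> out_arcs_in B v" for f
      proof -
        have tl: "tail D f = root" using f True by (simp add: out_arcs_in_def)
        have "unit_laplacian (B - {f}) = unit_laplacian B"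
          by (rule eq_matI)
             (use tl k_less in \<open>auto simp: unit_laplacian_def[THEN arg_cong[where f=dim_row]]
               unit_laplacian_def[THEN arg_cong[where f=dim_col]] intro!: unit_laplacian_Diff_index\<close>)
        then show "det (unit_laplacian (B - {f})) = det (unit_laplacian B)" by simp
        show "weight (B - {f}) = weight B"
          unfolding weight_def by (rule prod.cong) (auto simp: out_arcs_in_Diff tl)
        show "card (out_arcs_in (B - {f}) root) = card (out_arcs_in B root) - 1"
          using f fin True by (simp add: out_arcs_in_Diff tl)
      qed
      then have "int (card (trails v B)) = det (unit_laplacian B) * int (weight B)
          * (int (card (out_arcs_in B root)) * fact (card (out_arcs_in B root) - 1))"
        unfolding rec by (simp add: True mult_ac)
      \<comment> \<open>The identity d (d - 1)! = d! fails for d = 0, where the left side is 0; the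
        zero determinant settles that case.\<close>
      moreover have "det (unit_laplacian B) = 0" if "card (out_arcs_in B root) = 0"
        using det_unit_laplacian_eq_0[OF less.prems(1) False] less.prems(2) True that fin by simp
      ultimately show ?thesis
        by (cases "card (out_arcs_in B root)") simp_all
    next
      case False
      obtain i where i: "i < length vs" "v = vs ! i"
        using less.prems(3) set_vs by (metis in_set_conv_nth)
      then have ik: "i \<noteq> k" using False by auto
      \<comment> \<open>\<open>r\<close> collects the factors that the removal of an arc out of
        \<open>v\<close> does not change.\<close>
      define r where "r = (\<Prod>x \<in> verts D - {root} - {v}. fact (card (out_arcs_in B x) - 1)) *
          (fact (card (out_arcs_in B root)) :: nat)"
      have v: "v \<in> verts D - {root}" using False less.prems(3) by simp
      have w: "weight B * fact (card (out_arcs_in B root)) = fact (card (out_arcs_in B v) - 1) * r"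
        unfolding weight_def r_def by (subst prod.remove[OF _ v]) (simp_all add: mult_ac)
      have w': "weight (B - {f}) * fact (card (out_arcs_in (B - {f}) root))
          = fact (card (out_arcs_in B v) - 1 - 1) * r" if f: "f \<in> out_arcs_in B v" for f
      proof -
        have tl: "tail D f = v" using f by (simp add: out_arcs_in_def)
        have "(\<Prod>x \<in> verts D - {root} - {v}. fact (card (out_arcs_in (B - {f}) x) - 1))
          = (\<Prod>x \<in> verts D - {root} - {v}. fact (card (out_arcs_in B x) - 1) :: nat)"
          by (rule prod.cong) (auto simp: out_arcs_in_Diff tl)
        moreover have "card (out_arcs_in (B - {f}) v) = card (out_arcs_in B v) - 1"
          using f fin by (simp add: out_arcs_in_Diff tl)
        moreover have "out_arcs_in (B - {f}) root = out_arcs_in B root"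
          using False by (simp add: out_arcs_in_Diff tl)
        ultimately show ?thesis
          unfolding weight_def r_def by (subst prod.remove[OF _ v]) (simp_all add: mult_ac)
      qed
      have w'_int: "int (weight (B - {f})) * fact (card (out_arcs_in (B - {f}) root))
          = fact (card (out_arcs_in B v) - 1 - 1) * int r" if "f \<in> out_arcs_in B v" for f
        using w'[OF that, THEN arg_cong[where f = int]] by simp
      have "int (card (trails v B)) = (\<Sum>f \<in> out_arcs_in B v. det (unit_laplacian (B - {f}))
          * fact (card (out_arcs_in B v) - 1 - 1)) * int r"
        unfolding rec sum_distrib_right using w'_int by (intro sum.cong) (simp_all add: mult.assoc)
      also have "\<dots> = det (unit_laplacian B) * (fact (card (out_arcs_in B v) - 1) * int r)"
        by (simp only: sum_det_Diff[OF fin less.prems(1,2) i(1) ik i(2)] mult.assoc)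
      also have "fact (card (out_arcs_in B v) - 1) * int r
          = int (weight B) * fact (card (out_arcs_in B root))"
        using w[THEN arg_cong[where f = int]] by simp
      finally show ?thesis by (simp add: mult_ac)
    qed
  qed
qed

end

section \<open>Eulerian circuits and cycles\<close>

context pre_digraph
begin

lemma cas_append_mid: "cas u p v \<Longrightarrow> cas v q w \<Longrightarrow> cas u (p @ q) w"
  by (induction p arbitrary: u) auto

lemma eulerian_circuits_iff:
  "p \<in> eulerian_circuits G \<longleftrightarrow> (\<exists>u \<in> verts G. cas u p u) \<and> distinct p \<and> set p = arcs G"
  by (auto simp: eulerian_circuits_def trail_def awalk_def)

end

context fin_digraph
begin

lemma finite_eulerian_circuits: "finite (eulerian_circuits G)"
  by (rule finite_subset[OF _ finite_lists_length_eq[OF finite_arcs, of "card (arcs G)"]])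
     (auto simp: eulerian_circuits_iff distinct_card[symmetric])

lemma rotate1_eulerian_circuits:
  assumes "p \<in> eulerian_circuits G" shows "rotate1 p \<in> eulerian_circuits G"
proof (cases p)
  case (Cons a q)
  then have "a \<in> arcs G" "cas (head G a) q (tail G a)"
    using assms by (auto simp: eulerian_circuits_iff)
  then have "cas (head G a) (q @ [a]) (head G a)" "head G a \<in> verts G"
    using cas_append_mid[of "head G a" q "tail G a" "[a]" "head G a"] by simp_all
  then show ?thesis using assms Cons by (auto simp: eulerian_circuits_iff)
qed (use assms in simp)

lemma rotate_eulerian_circuits: "p \<in> eulerian_circuits G \<Longrightarrow> rotate n p \<in> eulerian_circuits G"
  by (induction n) (simp_all add: rotate1_eulerian_circuits)

lemma equiv_eulerian_rotation: "equiv (eulerian_circuits G) (eulerian_rotation G)"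
proof (rule equivI)
  show "sym (eulerian_rotation G)"
  proof (rule symI)
    fix p q assume pq: "(p, q) \<in> eulerian_rotation G"
    then obtain n where q: "q = rotate n p" by (auto simp: eulerian_rotation_def)
    \<comment> \<open>A further rotation by the complement of \<open>n\<close> modulo the length
      completes a full turn.\<close>
    have "rotate (length p - n mod length p) q = rotate (length p - n mod length p + n) p"
      by (simp add: q rotate_rotate)
    also have "\<dots> = p"
    proof (cases "p = []")
      case False
      then have "n mod length p < length p" by simp
      then have "length p - n mod length p + n = length p + length p * (n div length p)"
        using mult_div_mod_eq[of "length p" n] by linarith
      then show ?thesis by (simp add: rotate_id)
    qed simp
    finally show "(q, p) \<in> eulerian_rotation G"
      using pq by (auto simp: eulerian_rotation_def intro: sym)
  qed
  show "trans (eulerian_rotation G)"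
    by (rule transI) (auto simp: eulerian_rotation_def rotate_rotate)
  show "refl_on (eulerian_circuits G) (eulerian_rotation G)"
    by (auto simp: eulerian_rotation_def refl_on_def intro: exI[of _ 0])
qed (auto simp: eulerian_rotation_def)

text \<open>An Eulerian circuit passes \<open>e\<close> exactly once, so each rotation class has
  exactly one member that begins with \<open>e\<close>.\<close>

lemma ec_eq_card_hd:
  assumes e: "e \<in> arcs G"
  shows "ec G = card {p \<in> eulerian_circuits G. hd p = e}"
proof -
  let ?E = "eulerian_circuits G" and ?R = "eulerian_rotation G"
  let ?S = "{p \<in> ?E. hd p = e}"
  have "inj_on (\<lambda>p. ?R `` {p}) ?S"
  proof (rule inj_onI)
    fix p q assume p: "p \<in> ?S" and q: "q \<in> ?S" and eq: "?R `` {p} = ?R `` {q}"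
    have "(p, q) \<in> ?R" using eq_equiv_class[OF eq equiv_eulerian_rotation] q by simp
    then obtain n where n: "q = rotate n p" by (auto simp: eulerian_rotation_def)
    have "p \<noteq> []" using p e by (auto simp: eulerian_circuits_iff)
    then have "p ! (n mod length p) = p ! 0"
      using p q by (simp add: n hd_rotate_conv_nth hd_conv_nth[symmetric])
    then have "n mod length p = 0"
      using p \<open>p \<noteq> []\<close> by (subst (asm) nth_eq_iff_index_eq) (auto simp: eulerian_circuits_iff)
    then show "p = q" by (simp add: n rotate_id)
  qed
  moreover have "(\<lambda>p. ?R `` {p}) ` ?S = ?E // ?R"
  proof (intro equalityI subsetI)
    fix X assume "X \<in> ?E // ?R"
    then obtain p where p: "p \<in> ?E" "X = ?R `` {p}" by (auto elim: quotientE)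
    then have "e \<in> set p" using e by (auto simp: eulerian_circuits_iff)
    then obtain i where i: "i < length p" "p ! i = e" by (auto simp: in_set_conv_nth)
    have "p \<noteq> []" using i by auto
    then have hd: "hd (rotate i p) = e" using i by (simp add: hd_rotate_conv_nth)
    have r: "rotate i p \<in> ?E" using p by (simp add: rotate_eulerian_circuits)
    then have "(p, rotate i p) \<in> ?R" using p by (auto simp: eulerian_rotation_def)
    then have "X = ?R `` {rotate i p}" using equiv_class_eq[OF equiv_eulerian_rotation] p by simp
    then show "X \<in> (\<lambda>p. ?R `` {p}) ` ?S" using r hd by blast
  qed (auto intro: quotientI)
  ultimately show ?thesis
    using card_image[of "\<lambda>p. ?R `` {p}" ?S] by (simp only: ec_def)
qed

text \<open>Every arc serves equally well as first arc. Without arcs the formula would fail on a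
  digraph with a vertex, where the empty list is an Eulerian circuit.\<close>

lemma card_eulerian_circuits:
  assumes "arcs G \<noteq> {}"
  shows "card (eulerian_circuits G) = card (arcs G) * ec G"
proof -
  have "hd p \<in> arcs G" if "p \<in> eulerian_circuits G" for p
  proof -
    have "set p = arcs G" using that by (simp add: eulerian_circuits_iff)
    moreover from this have "p \<noteq> []" using assms by auto
    ultimately show ?thesis using hd_in_set[of p] by simp
  qed
  then have "eulerian_circuits G = (\<Union>e \<in> arcs G. {p \<in> eulerian_circuits G. hd p = e})" by auto
  then have "card (eulerian_circuits G) = card (\<Union>e \<in> arcs G. {p \<in> eulerian_circuits G. hd p = e})"
    by simp
  also have "\<dots> = (\<Sum>e \<in> arcs G. card {p \<in> eulerian_circuits G. hd p = e})"
    by (rule card_UN_disjoint) (auto simp: finite_eulerian_circuits)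
  finally show ?thesis by (simp add: ec_eq_card_hd[symmetric])
qed

end

context rooted_digraph
begin

text \<open>Behind the fixed first arc \<open>e\<close>, the rest is a trail from its head back to
  the root. Removing \<open>e\<close> lowers the outdegree d of the root by one, so the factor of
  the root in \<open>card_trails\<close> becomes (d - 1)! and the product is uniform over all
  vertices.\<close>

lemma ec_eq_det:
  assumes e: "e \<in> arcs D" "tail D e = root"
    and bal: "\<And>x. card (out_arcs_in (arcs D) x) = card (in_arcs_in (arcs D) x)"
  shows "int (ec D) = det (unit_laplacian (arcs D - {e}))
    * (\<Prod>x \<in> verts D. fact (card (out_arcs_in (arcs D) x) - 1))"
proof -
  let ?B = "arcs D - {e}"
  have root: "root \<in> verts D" using e tail_in_verts by metis
  have "{p \<in> eulerian_circuits D. hd p = e} = (#) e ` trails (head D e) ?B"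
  proof (intro equalityI subsetI)
    fix p assume p: "p \<in> {p \<in> eulerian_circuits D. hd p = e}"
    then have "p \<noteq> []" using e by (auto simp: eulerian_circuits_iff)
    then obtain q where "p = e # q" using p by (cases p) auto
    then show "p \<in> (#) e ` trails (head D e) ?B"
      using p e by (auto simp: eulerian_circuits_iff trails_def)
  next
    fix p assume "p \<in> (#) e ` trails (head D e) ?B"
    then obtain q where "p = e # q" "q \<in> trails (head D e) ?B" by blast
    then show "p \<in> {p \<in> eulerian_circuits D. hd p = e}"
      using e root by (auto simp: eulerian_circuits_iff trails_def)
  qed
  then have "ec D = card (trails (head D e) ?B)"
    by (simp add: ec_eq_card_hd[OF e(1)] card_image)
  moreover have "balanced (head D e) ?B"
    using bal e by (intro balanced_Diff[of root]) (auto simp: balanced_def out_arcs_in_def)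
  ultimately have "int (ec D) = det (unit_laplacian ?B) * int (weight ?B)
      * fact (card (out_arcs_in ?B root))"
    using card_trails[of ?B "head D e"] e by simp
  moreover have "int (weight ?B) * fact (card (out_arcs_in ?B root))
      = (\<Prod>x \<in> verts D. fact (card (out_arcs_in (arcs D) x) - 1))"
  proof -
    have "weight ?B = (\<Prod>x \<in> verts D - {root}. fact (card (out_arcs_in (arcs D) x) - 1))"
      unfolding weight_def by (rule prod.cong) (auto simp: out_arcs_in_Diff e)
    moreover have "e \<in> out_arcs_in (arcs D) root" using e by (simp add: out_arcs_in_def)
    then have "card (out_arcs_in ?B root) = card (out_arcs_in (arcs D) root) - 1"
      by (simp add: out_arcs_in_Diff e)
    ultimately show ?thesis by (simp add: prod.remove[OF finite_verts root] mult_ac)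
  qed
  ultimately show ?thesis by (simp add: mult_ac)
qed

end

section \<open>Labelled lists\<close>

lemma count_list_map_distinct:
  "distinct q \<Longrightarrow> count_list (map f q) y = card {x \<in> set q. f x = y}"
proof (induction q)
  case (Cons x q)
  have "{z \<in> set (x # q). f z = y} = (if f x = y then insert x {z \<in> set q. f z = y} else {z \<in> set q. f z = y})"
    by auto
  then show ?case using Cons by simp
qed simp

text \<open>The first entry of \<open>p\<close> can be labelled by any element of its fibre; the
  chosen label is then used up, so fibre and count drop together. Elements of \<open>A\<close>
  outside \<open>p\<close> contribute 0! = 1.\<close>

lemma card_list_fibre:
  assumes "finite A" "finite B" "set p \<subseteq> A" "\<And>y. card {x \<in> B. f x = y} = count_list p y"
  shows "card {q. map f q = p \<and> distinct q \<and> set q = B} = (\<Prod>y \<in> A. fact (count_list p y))"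
  using assms(2-)
proof (induction p arbitrary: B)
  case Nil
  have "B = {}"
  proof (rule ccontr)
    assume "B \<noteq> {}"
    then obtain x where "x \<in> B" by blast
    then have "x \<in> {z \<in> B. f z = f x}" by simp
    then show False using Nil(3)[of "f x"] Nil(1) by auto
  qed
  then have "{q. map f q = [] \<and> distinct q \<and> set q = B} = {[]}" by auto
  then show ?case by simp
next
  case (Cons a p)
  define S where "S p B = {q. map f q = p \<and> distinct q \<and> set q = B}" for p B
  let ?Ba = "{x \<in> B. f x = a}"
  have eq: "S (a # p) B = (\<Union>x \<in> ?Ba. (#) x ` S p (B - {x}))" (is "_ = ?R")
  proof (intro equalityI subsetI)
    fix q assume "q \<in> S (a # p) B"
    then show "q \<in> ?R" by (cases q) (auto simp: S_def)
  next
    fix q assume "q \<in> ?R"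
    then obtain x r where "x \<in> B" "f x = a" "q = x # r" "r \<in> S p (B - {x})" by blast
    then show "q \<in> S (a # p) B" by (simp add: S_def insert_absorb)
  qed
  have fin: "finite (S p B')" if "finite B'" for p B'
    by (rule finite_subset[OF _ finite_lists_length_eq[OF that, of "length p"]])
       (auto simp: S_def)
  have IH: "card (S p (B - {x})) = (\<Prod>y \<in> A. fact (count_list p y))" if x: "x \<in> ?Ba" for x
    unfolding S_def
  proof (rule Cons.IH)
    fix y
    have "{z \<in> B - {x}. f z = y} = {z \<in> B. f z = y} - {x}" by auto
    then show "card {z \<in> B - {x}. f z = y} = count_list p y"
      using Cons.prems(1) Cons.prems(3)[of y] x by (cases "y = a") auto
  qed (use Cons.prems in auto)
  have "card ?R = (\<Sum>x \<in> ?Ba. card ((#) x ` S p (B - {x})))"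
  proof (rule card_UN_disjoint)
    show "finite ?Ba" using Cons.prems(1) by simp
    show "\<forall>x \<in> ?Ba. finite ((#) x ` S p (B - {x}))" using Cons.prems(1) fin by simp
    show "\<forall>x \<in> ?Ba. \<forall>y \<in> ?Ba. x \<noteq> y \<longrightarrow> (#) x ` S p (B - {x}) \<inter> (#) y ` S p (B - {y}) = {}"
      by blast
  qed
  also have "\<dots> = (\<Sum>x \<in> ?Ba. \<Prod>y \<in> A. fact (count_list p y))"
    using IH by (intro sum.cong) (simp_all add: card_image)
  also have "\<dots> = Suc (count_list p a) * (\<Prod>y \<in> A. fact (count_list p y))"
    using Cons.prems(3)[of a] by simp
  also have "\<dots> = (\<Prod>y \<in> A. fact (count_list (a # p) y))"
  proof -
    have a: "a \<in> A" using Cons.prems(2) by simp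
    have "(\<Prod>y \<in> A - {a}. fact (count_list (a # p) y)) = (\<Prod>y \<in> A - {a}. fact (count_list p y) :: nat)"
      by (rule prod.cong) auto
    then show ?thesis
      unfolding prod.remove[OF assms(1) a] by (simp add: algebra_simps)
  qed
  finally show ?case using eq by (simp add: S_def)
qed

section \<open>Flows and their lifts\<close>

locale flow_multigraph = multigraph G arev for G :: "('a, 'b) pre_digraph" and arev +
  fixes O1 :: "'b set" and \<alpha> :: "'b \<Rightarrow>\<^sub>0 int"
  assumes O1: "orientation G arev O1" and flow: "flow G arev O1 \<alpha>"
begin

abbreviation P :: "'b set" where "P \<equiv> flow_orientation G arev O1 \<alpha>"
abbreviation c :: "'b \<Rightarrow> nat" where "c e \<equiv> nat (deg arev O1 \<alpha> e)"
abbreviation D :: "('a, 'b \<times> nat) pre_digraph" where "D \<equiv> lift G arev O1 \<alpha>"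

section \<open>The orientation along the flow\<close>

lemma orientation_P: "orientation G arev P"
  using flow_orientation_unique[OF O1 flow, of P "deg arev O1 \<alpha>"] by blast

lemma P_subset: "P \<subseteq> arcs G"
  using orientation_P by (rule orientation_subset)

lemma finite_P: "finite P"
  using P_subset finite_arcs by (rule finite_subset)

lemma keys_flow: "Poly_Mapping.keys \<alpha> \<subseteq> O1"
  using flow by (simp add: flow_def H1_def free_Abelian_group_def)

lemma deg_pos: "e \<in> P \<Longrightarrow> deg arev O1 \<alpha> e > 0"
  by (simp add: flow_orientation_def)

text \<open>The oriented edges are the disjoint union of \<open>Q\<close> and its reversal.\<close>

lemma sum_arcs_orientation:
  fixes f :: "'b \<Rightarrow> 'c :: comm_monoid_add"
  assumes Q: "orientation G arev Q"
  shows "sum f (arcs G) = (\<Sum>e \<in> Q. f e + f (arev e))"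
proof -
  have sub: "Q \<subseteq> arcs G" using Q by (rule orientation_subset)
  then have fin: "finite Q" using finite_arcs by (rule finite_subset)
  have inj: "inj_on arev Q" by (metis arev_arev inj_onI)
  have "arcs G = Q \<union> arev ` Q"
  proof (intro equalityI subsetI)
    fix e assume e: "e \<in> arcs G"
    show "e \<in> Q \<union> arev ` Q"
    proof (cases "e \<in> Q")
      case False
      then have "arev e \<in> Q" using orientation_arev_iff[OF Q e] by simp
      then have "arev (arev e) \<in> arev ` Q" by (rule imageI)
      then show ?thesis by simp
    qed simp
  qed (use sub in auto)
  moreover have "Q \<inter> arev ` Q = {}" using orientation_arev_iff[OF Q] sub by auto
  ultimately have "sum f (arcs G) = sum f Q + sum f (arev ` Q)"
    using fin by (simp add: sum.union_disjoint)
  then show ?thesis using inj by (simp add: sum.reindex sum.distrib)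
qed

text \<open>The absolute degree agrees on \<open>e\<close> and \<open>arev e\<close>, so its sum
  over any orientation is half of the sum over all oriented edges; \<open>O1\<close> and
  \<open>P\<close> give the same value.\<close>

lemma chain_norm_eq: "chain_norm O1 \<alpha> = (\<Sum>e \<in> P. c e)"
proof -
  let ?f = "\<lambda>e. nat \<bar>deg arev O1 \<alpha> e\<bar>"
  have f: "(\<Sum>e \<in> Q. ?f e + ?f (arev e)) = 2 * (\<Sum>e \<in> Q. ?f e)" if "orientation G arev Q" for Q
    unfolding sum_distrib_left
    by (rule sum.cong) (use orientation_subset[OF that] in \<open>auto simp: deg_arev[OF O1]\<close>)
  have "(\<Sum>e \<in> O1. ?f e) = (\<Sum>e \<in> P. ?f e)"
    using sum_arcs_orientation[OF O1, of ?f] sum_arcs_orientation[OF orientation_P, of ?f]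
    by (simp add: f[OF O1] f[OF orientation_P])
  moreover have "(\<Sum>e \<in> O1. ?f e) = chain_norm O1 \<alpha>"
    unfolding chain_norm_def by (rule sum.cong) (simp_all add: deg_def)
  moreover have "(\<Sum>e \<in> P. ?f e) = (\<Sum>e \<in> P. c e)"
    by (rule sum.cong) (simp_all add: deg_pos abs_of_pos)
  ultimately show ?thesis by simp
qed

section \<open>The lift and its degrees\<close>

lemma verts_lift [simp]: "verts D = verts G"
  and arcs_lift: "arcs D = (SIGMA e : P. {..<c e})"
  and tail_lift [simp]: "tail D x = tail G (fst x)"
  and head_lift [simp]: "head D x = head G (fst x)"
  by (simp_all add: lift_def)

lemma card_arcs_lift: "card (arcs D) = chain_norm O1 \<alpha>"
  unfolding arcs_lift chain_norm_eq by (simp add: finite_P)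

lemma fin_digraph_lift: "fin_digraph D"
  by unfold_locales (use P_subset in \<open>auto simp: arcs_lift finite_P\<close>)

lemma card_arcs_lift_restrict:
  "card {x \<in> arcs D. R (fst x)} = (\<Sum>e | e \<in> P \<and> R e. c e)"
proof -
  have "{x \<in> arcs D. R (fst x)} = (SIGMA e : {e \<in> P. R e}. {..<c e})"
    by (auto simp: arcs_lift)
  then show ?thesis by (simp add: finite_P)
qed

lemma card_arcs_lift_restrict_int:
  "int (card {x \<in> arcs D. R (fst x)}) = (\<Sum>e | e \<in> P \<and> R e. deg arev O1 \<alpha> e)"
  unfolding card_arcs_lift_restrict int_sum by (rule sum.cong) (auto dest: deg_pos)

lemma card_lift_fibre: "card {x \<in> arcs D. fst x = e} = (if e \<in> P then c e else 0)"
proof -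
  have "{x. x \<in> P \<and> x = e} = (if e \<in> P then {e} else {})" by auto
  then show ?thesis using card_arcs_lift_restrict[of "\<lambda>x. x = e"] by simp
qed

text \<open>This is \<open>vdeg\<close> = 0 read in the lift: an oriented edge that leaves
  \<open>v\<close> against the flow is the reverse of an edge of \<open>P\<close> entering
  \<open>v\<close>, and has the opposite degree.\<close>

lemma lift_balanced:
  "card {x \<in> arcs D. tail D x = v} = card {x \<in> arcs D. head D x = v}"
proof (cases "v \<in> verts G")
  case True
  let ?d = "deg arev O1 \<alpha>"
  have "0 = vdeg G arev O1 \<alpha> v" using flow True by (simp add: flow_def H1_def)
  also have "\<dots> = (\<Sum>e \<in> arcs G. if tail G e = v then ?d e else 0)"
    unfolding vdeg_def by (simp add: sum.inter_filter)
  also have "\<dots> = (\<Sum>e \<in> P. (if tail G e = v then ?d e else 0) - (if head G e = v then ?d e else 0))"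
    unfolding sum_arcs_orientation[OF orientation_P]
    by (rule sum.cong) (use P_subset in \<open>auto simp: deg_arev[OF O1] subset_iff\<close>)
  also have "\<dots> = (\<Sum>e | e \<in> P \<and> tail G e = v. ?d e) - (\<Sum>e | e \<in> P \<and> head G e = v. ?d e)"
    by (simp add: sum_subtractf sum.inter_filter finite_P)
  finally have "int (card {x \<in> arcs D. tail D x = v}) = int (card {x \<in> arcs D. head D x = v})"
    by (simp add: card_arcs_lift_restrict_int[of "\<lambda>e. tail G e = v"]
        card_arcs_lift_restrict_int[of "\<lambda>e. head G e = v"])
  then show ?thesis by simp
next
  case False
  then have "{x \<in> arcs D. tail D x = v} = {}" "{x \<in> arcs D. head D x = v} = {}"
    using P_subset by (auto simp: arcs_lift)
  then show ?thesis by (simp only: card.empty)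
qed

text \<open>Some edge of \<open>P\<close> touches \<open>v\<close>; if it enters \<open>v\<close>,
  balance supplies an arc that leaves.\<close>

lemma exists_lift_arc:
  assumes "v \<in> verts G"
  obtains x where "x \<in> arcs D" "tail D x = v"
proof -
  obtain e where e: "e \<in> arcs G" "tail G e = v \<or> head G e = v" using no_isolated[OF assms] by blast
  obtain e' where e': "e' \<in> P" "tail G e' = v \<or> head G e' = v"
  proof (cases "e \<in> P")
    case False
    then have "arev e \<in> P" using orientation_arev_iff[OF orientation_P e(1)] by simp
    then show ?thesis using that[of "arev e"] e by auto
  qed (use e that in blast)
  then have x: "(e', 0) \<in> arcs D" using deg_pos by (auto simp: arcs_lift)
  have "{x \<in> arcs D. tail D x = v} \<noteq> {}"
  proof (cases "tail G e' = v")
    case False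
    then have "(e', 0) \<in> {x \<in> arcs D. head D x = v}" using e' x by simp
    then have "card {x \<in> arcs D. head D x = v} > 0"
      using fin_digraph.finite_arcs[OF fin_digraph_lift] by (subst card_gt_0_iff) auto
    then have "card {x \<in> arcs D. tail D x = v} \<noteq> 0" using lift_balanced[of v] by simp
    then show ?thesis by (metis card.empty)
  next
    case True
    then have "(e', 0) \<in> {x \<in> arcs D. tail D x = v}" using x by simp
    then show ?thesis by blast
  qed
  then show thesis using that by blast
qed

section \<open>Abelianizations and circuits of minimal length\<close>

lemma deg_abelianization:
  assumes "set p \<subseteq> arcs G" "x \<in> arcs G"
  shows "deg arev O1 (abelianization arev O1 p) x = int (count_list p x) - int (count_list p (arev x))"
  using assms(1)
proof (induction p)
  case Nil
  then show ?case by (simp add: abelianization_def deg_def)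
next
  case (Cons e p)
  have add: "deg arev O1 (a + b) x = deg arev O1 a x + deg arev O1 b x" for a b
    by (simp add: deg_def lookup_add)
  have "arev x = e \<longleftrightarrow> x = arev e" by (metis arev_arev)
  moreover have "x \<noteq> arev x" using arev_neq[OF assms(2)] by simp
  ultimately show ?case
    using Cons assms(2) add deg_chain_of[OF O1, of e x]
    by (auto simp: abelianization_def)
qed

lemma keys_abelianization:
  "set p \<subseteq> arcs G \<Longrightarrow> Poly_Mapping.keys (abelianization arev O1 p) \<subseteq> O1"
proof (induction p)
  case (Cons e p)
  then have "e \<in> O1 \<or> arev e \<in> O1" using orientation_arev_iff[OF O1, of e] by auto
  then have "Poly_Mapping.keys (chain_of arev O1 e) \<subseteq> O1" by (auto simp: chain_of_def)
  moreover have "Poly_Mapping.keys (abelianization arev O1 p) \<subseteq> O1" using Cons by simp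
  ultimately show ?case
    using Poly_Mapping.keys_add[of "chain_of arev O1 e" "abelianization arev O1 p"]
    by (auto simp: abelianization_def)
qed (simp add: abelianization_def)

lemma length_eq_sum_P:
  assumes "set p \<subseteq> arcs G"
  shows "length p = (\<Sum>e \<in> P. count_list p e + count_list p (arev e))"
  using sum_count_set[OF assms finite_arcs] sum_arcs_orientation[OF orientation_P, of "count_list p"]
  by simp

lemma chain_norm_pos:
  assumes "verts G \<noteq> {}" shows "chain_norm O1 \<alpha> > 0"
proof -
  obtain v where "v \<in> verts G" using assms by blast
  then obtain x where "x \<in> arcs D" by (rule exists_lift_arc)
  then show ?thesis
    using fin_digraph.finite_arcs[OF fin_digraph_lift] by (auto simp: card_arcs_lift[symmetric] card_gt_0_iff)
qed

text \<open>
  The length \<open>\<parallel>\<alpha>\<parallel>\<close> is minimal for a walk with abelianization \<open>\<alpha>\<close>, so such a walk has no room for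
  edges traversed against the flow; conversely a walk along the flow cannot backtrack.
\<close>

lemma circuits_iff:
  assumes ne: "verts G \<noteq> {}"
  shows "p \<in> circuits G arev O1 \<alpha> (chain_norm O1 \<alpha>) \<longleftrightarrow>
    (\<exists>u \<in> verts G. cas u p u) \<and> (\<forall>e. count_list p e = (if e \<in> P then c e else 0))"
    (is "?L \<longleftrightarrow> ?R")
proof
  assume ?L
  then obtain u where u: "awalk u p u" and len: "length p = chain_norm O1 \<alpha>"
    and ab: "abelianization arev O1 p = \<alpha>" by (auto simp: circuits_def circuit_def)
  have sub: "set p \<subseteq> arcs G" using u by auto
  have cnt: "count_list p e = c e + count_list p (arev e)" if e: "e \<in> P" for e
    using deg_abelianization[OF sub, of e] P_subset e deg_pos[OF e] by (auto simp: ab)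
  \<comment> \<open>If \<open>e\<close> is traversed r times backwards, it is traversed
    \<open>c e\<close> + r times forwards, so the length exceeds the norm by twice the number of
    backward steps.\<close>
  have "(\<Sum>e \<in> P. c e) = (\<Sum>e \<in> P. c e + 2 * count_list p (arev e))"
    using len length_eq_sum_P[OF sub] by (simp add: chain_norm_eq cnt mult_2 add.assoc)
  then have "(\<Sum>e \<in> P. count_list p (arev e)) = 0"
    by (simp add: sum.distrib sum_distrib_left[symmetric])
  then have zero: "count_list p (arev e) = 0" if "e \<in> P" for e using that finite_P by simp
  have "count_list p e = (if e \<in> P then c e else 0)" for e
  proof (cases "e \<in> P \<or> e \<notin> arcs G")
    case True
    then show ?thesis using cnt[of e] zero[of e] sub P_subset by (auto simp: count_list_0_iff)
  next
    case False
    then have "arev e \<in> P" using orientation_arev_iff[OF orientation_P, of e] by simp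
    then show ?thesis using zero[of "arev e"] False by simp
  qed
  then show ?R using u by (auto simp: awalk_def)
next
  assume R: ?R
  then obtain u where u: "u \<in> verts G" "cas u p u" by blast
  have "e \<in> P" if "e \<in> set p" for e
  proof (rule ccontr)
    assume "e \<notin> P"
    then have "count_list p e = 0" using R by simp
    then show False using that by (simp add: count_list_0_iff)
  qed
  then have P: "set p \<subseteq> P" by blast
  then have sub: "set p \<subseteq> arcs G" using P_subset by blast
  have arev_P: "arev e \<notin> P" if "e \<in> P" for e
    using orientation_arev_iff[OF orientation_P] P_subset that by blast
  have len: "length p = chain_norm O1 \<alpha>"
    using length_eq_sum_P[OF sub] R arev_P by (simp add: chain_norm_eq)
  have "abelianization arev O1 p = \<alpha>"
  proof (rule chain_eqI[OF O1 orientation_P keys_abelianization[OF sub] keys_flow])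
    fix x assume x: "x \<in> P"
    then show "deg arev O1 (abelianization arev O1 p) x = deg arev O1 \<alpha> x"
      using deg_abelianization[OF sub, of x] P_subset R arev_P[OF x] deg_pos[OF x] by auto
  qed
  moreover have "p \<noteq> []" using len chain_norm_pos[OF ne] by auto
  moreover have "p ! Suc i \<noteq> arev (p ! i)" if "Suc i < length p" for i
  proof -
    have "p ! i \<in> P" "p ! Suc i \<in> P" using P that by (auto dest: Suc_lessD)
    then show ?thesis using arev_P by metis
  qed
  moreover have "hd p \<noteq> arev (last p)"
  proof -
    have "hd p \<in> P" "last p \<in> P" using P \<open>p \<noteq> []\<close> hd_in_set last_in_set by blast+
    then show ?thesis using arev_P by metis
  qed
  moreover have "awalk u p u" using u sub by (simp add: awalk_def)
  ultimately show ?L using len by (auto simp: circuits_def circuit_def)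
qed

section \<open>Circuits compared with Eulerian circuits of the lift\<close>

lemma cas_lift: "pre_digraph.cas D u q v \<longleftrightarrow> cas u (map fst q) v"
  by (induction q arbitrary: u) (simp_all add: pre_digraph.cas.simps)

text \<open>A list of all arcs of the lift without repetition projects to one with the right
  multiplicities automatically, so \<open>circuits_iff\<close> leaves only the condition of being a
  closed walk.\<close>

lemma eulerian_circuits_lift:
  assumes "verts G \<noteq> {}"
  shows "eulerian_circuits D =
    {q. map fst q \<in> circuits G arev O1 \<alpha> (chain_norm O1 \<alpha>) \<and> distinct q \<and> set q = arcs D}"
proof -
  have "count_list (map fst q) e = (if e \<in> P then c e else 0)"
    if "distinct q" "set q = arcs D" for q e
    using that by (simp only: count_list_map_distinct card_lift_fibre)
  then show ?thesis
    by (auto simp: circuits_iff[OF assms] pre_digraph.eulerian_circuits_iff cas_lift)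
qed

text \<open>Eulerian circuits of the lift are counted twice: by their projections, whose fibres all
  have the same size by \<open>card_list_fibre\<close>, and by their rotation classes.\<close>

lemma card_circuits:
  assumes ne: "verts G \<noteq> {}"
  shows "card (circuits G arev O1 \<alpha> (chain_norm O1 \<alpha>)) * (\<Prod>e \<in> P. fact (c e))
         = chain_norm O1 \<alpha> * ec D"
proof -
  let ?C = "circuits G arev O1 \<alpha> (chain_norm O1 \<alpha>)"
  let ?F = "\<lambda>p. {q. map fst q = p \<and> distinct q \<and> set q = arcs D}"
  interpret lifted: fin_digraph D by (rule fin_digraph_lift)
  have fin: "finite ?C"
    by (rule finite_subset[OF _ finite_lists_length_eq[OF finite_arcs, of "chain_norm O1 \<alpha>"]])
       (auto simp: circuits_def circuit_def)
  have fibre: "card (?F p) = (\<Prod>e \<in> P. fact (c e))" if p: "p \<in> ?C" for p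
  proof -
    have cnt: "count_list p e = (if e \<in> P then c e else 0)" for e
      using p circuits_iff[OF ne] by blast
    have "set p \<subseteq> P"
    proof
      fix e assume "e \<in> set p"
      then have "count_list p e \<noteq> 0" by (simp add: count_list_0_iff)
      then show "e \<in> P" using cnt[of e] by (auto split: if_splits)
    qed
    then have "card (?F p) = (\<Prod>e \<in> P. fact (count_list p e))"
      using cnt by (intro card_list_fibre finite_P lifted.finite_arcs) (simp_all add: card_lift_fibre)
    then show ?thesis using cnt by simp
  qed
  have "eulerian_circuits D = (\<Union>p \<in> ?C. ?F p)"
    unfolding eulerian_circuits_lift[OF ne] by blast
  then have "card (eulerian_circuits D) = card (\<Union>p \<in> ?C. ?F p)" by simp
  also have "\<dots> = (\<Sum>p \<in> ?C. card (?F p))"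
  proof (rule card_UN_disjoint[OF fin])
    show "\<forall>p \<in> ?C. finite (?F p)"
    proof
      fix p
      show "finite (?F p)"
        by (rule finite_subset[OF _ finite_lists_length_eq[OF lifted.finite_arcs, of "length p"]]) auto
    qed
  qed blast
  also have "\<dots> = card ?C * (\<Prod>e \<in> P. fact (c e))" using fibre by simp
  finally have "card (eulerian_circuits D) = card ?C * (\<Prod>e \<in> P. fact (c e))" .
  moreover have "arcs D \<noteq> {}" using chain_norm_pos[OF ne] card_arcs_lift by auto
  ultimately show ?thesis using lifted.card_eulerian_circuits card_arcs_lift by simp
qed

text \<open>After the first arc is removed, the unit row of the root reduces the determinant of
  \<open>unit_laplacian\<close> to the minor that omits the root, and all other rows are those of
  \<open>laplacian\<close>.\<close>

lemma ec_lift: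
  assumes vs: "distinct vs" "set vs = verts G" "k < length vs"
  shows "int (ec D) = det (mat_delete (laplacian G arev O1 \<alpha> vs) k k)
    * (\<Prod>v \<in> verts G. fact (outdeg G arev O1 \<alpha> v - 1))"
proof -
  have nth: "vs ! i \<in> verts G" if "i < length vs" for i using that vs(2) nth_mem by blast
  have "rooted_digraph_axioms D vs k"
    by (rule rooted_digraph_axioms.intro) (use vs in simp_all)
  have "rooted_digraph D vs k"
    by (rule rooted_digraph.intro[OF fin_digraph_lift \<open>rooted_digraph_axioms D vs k\<close>])
  then interpret lifted: rooted_digraph D vs k .
  let ?n = "length vs" and ?out = "lifted.out_arcs_in (arcs D)"
  \<comment> \<open>\<open>x\<close> is the fixed first arc; as it leaves the root, its removal
    affects no other row.\<close>
  obtain x where x: "x \<in> arcs D" "tail D x = vs ! k" using nth[OF vs(3)] by (rule exists_lift_arc)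
  let ?M = "lifted.unit_laplacian (arcs D - {x})" and ?L = "laplacian G arev O1 \<alpha> vs"
  have out: "card (?out v) = outdeg G arev O1 \<alpha> v" for v
    unfolding lifted.out_arcs_in_def outdeg_def
    using card_arcs_lift_restrict[of "\<lambda>e. tail G e = v"] by simp
  have both: "int (card (?out u \<inter> lifted.in_arcs_in (arcs D) v))
      = (\<Sum>e | e \<in> P \<and> tail G e = u \<and> head G e = v. deg arev O1 \<alpha> e)" for u v
  proof -
    have "?out u \<inter> lifted.in_arcs_in (arcs D) v = {x \<in> arcs D. tail G (fst x) = u \<and> head G (fst x) = v}"
      by (auto simp: lifted.out_arcs_in_def lifted.in_arcs_in_def)
    then show ?thesis using card_arcs_lift_restrict_int[of "\<lambda>e. tail G e = u \<and> head G e = v"] by simp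
  qed
  have entry: "?M $$ (i, j) = ?L $$ (i, j)" if ij: "i < ?n" "j < ?n" "i \<noteq> k" for i j
  proof -
    \<comment> \<open>No vertex of the full lift is exhausted, so rows other than that of the root
      are genuine Laplacian rows.\<close>
    obtain y where "y \<in> arcs D" "tail D y = vs ! i" using nth[OF ij(1)] by (rule exists_lift_arc)
    then have ne: "?out (vs ! i) \<noteq> {}" unfolding lifted.out_arcs_in_def by blast
    have "vs ! i \<noteq> tail D x" using ij vs x by (simp add: nth_eq_iff_index_eq)
    then have "?M $$ (i, j) = lifted.unit_laplacian (arcs D) $$ (i, j)"
      using ij by (intro lifted.unit_laplacian_Diff_index) auto
    also have "\<dots> = ?L $$ (i, j)"
    proof (cases "i = j")
      case False
      then show ?thesis using ij ne by (simp add: lifted.unit_laplacian_def laplacian_def both)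
    next
      case True
      let ?T = "{e \<in> P. tail G e = vs ! i}"
      have o: "int (card (?out (vs ! i))) = (\<Sum>e \<in> ?T. deg arev O1 \<alpha> e)"
        using card_arcs_lift_restrict_int[of "\<lambda>e. tail G e = vs ! i"]
        by (simp add: lifted.out_arcs_in_def)
      \<comment> \<open>Loops are counted in the outdegree and cancel against the diagonal arc
        count, which leaves the loop-free sum of \<open>laplacian\<close>.\<close>
      have "?T = {e \<in> P. tail G e = vs ! i \<and> head G e = vs ! i}
          \<union> {e \<in> P. tail G e = vs ! i \<and> head G e \<noteq> vs ! i}" by auto
      then have "(\<Sum>e \<in> ?T. deg arev O1 \<alpha> e)
          = (\<Sum>e | e \<in> P \<and> tail G e = vs ! i \<and> head G e = vs ! i. deg arev O1 \<alpha> e)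
          + (\<Sum>e | e \<in> P \<and> tail G e = vs ! i \<and> head G e \<noteq> vs ! i. deg arev O1 \<alpha> e)"
        using finite_P by (simp only:) (rule sum.union_disjoint, auto)
      then show ?thesis
        using ij ne True by (simp add: lifted.unit_laplacian_def laplacian_def both o[unfolded True])
    qed
    finally show ?thesis .
  qed
  have "?M $$ (k, j) = of_bool (k = j)" if "j < ?n" for j
    using that vs by (simp add: lifted.unit_laplacian_def)
  then have "det ?M = cofactor ?M k k"
    by (rule det_unit_row[OF lifted.unit_laplacian_carrier vs(3)])
  also have "\<dots> = cofactor ?L k k"
    by (rule cofactor_cong[OF lifted.unit_laplacian_carrier _ vs(3,3)])
       (simp_all add: entry laplacian_def[of _ _ _ _ vs])
  also have "\<dots> = det (mat_delete ?L k k)" by (simp add: cofactor_def)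
  finally have det: "det ?M = det (mat_delete ?L k k)" .
  have "int (ec D) = det ?M * (\<Prod>v \<in> verts D. fact (card (?out v) - 1))"
    using x lift_balanced
    by (intro lifted.ec_eq_det) (simp_all add: lifted.out_arcs_in_def lifted.in_arcs_in_def)
  then show ?thesis by (simp add: det out)
qed

end

text \<open>The first equation is \<open>card_circuits\<close> divided by the factorials, which are
  nonzero in \<open>rat\<close>; the second substitutes \<open>ec_lift\<close>.\<close>

theorem theorem3p7:
  fixes G :: "('a, 'b) pre_digraph" and arev :: "'b \<Rightarrow> 'b"
    and O1 :: "'b set" and \<alpha> :: "'b \<Rightarrow>\<^sub>0 int"
    and vs :: "'a list" and k :: nat and w :: 'a
  assumes "multigraph G arev"
    and "orientation G arev O1"
    and "flow G arev O1 \<alpha>"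
    and "w \<in> verts G"
    and "distinct vs" and "set vs = verts G"
    and "k < length vs" and "vs ! k = w"
  shows "(of_nat (card (circuits G arev O1 \<alpha> (chain_norm O1 \<alpha>))) :: rat) =
           of_nat (chain_norm O1 \<alpha>) * of_nat (ec (lift G arev O1 \<alpha>)) *
           (\<Prod>e \<in> flow_orientation G arev O1 \<alpha>. inverse (fact (nat (deg arev O1 \<alpha> e)))) \<and>
         of_nat (chain_norm O1 \<alpha>) * of_nat (ec (lift G arev O1 \<alpha>)) *
           (\<Prod>e \<in> flow_orientation G arev O1 \<alpha>. inverse (fact (nat (deg arev O1 \<alpha> e)))) =
         (of_nat (chain_norm O1 \<alpha>) *
           of_int (det (mat_delete (laplacian G arev O1 \<alpha> vs) k k)) *
           (\<Prod>v \<in> verts G. fact (outdeg G arev O1 \<alpha> v - 1)) *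
           (\<Prod>e \<in> flow_orientation G arev O1 \<alpha>. inverse (fact (nat (deg arev O1 \<alpha> e)))) :: rat)"
proof -
  interpret flow_multigraph G arev O1 \<alpha>
    using assms(1-3) by (simp add: flow_multigraph_def flow_multigraph_axioms_def)
  let ?N = "rat_of_nat (card (circuits G arev O1 \<alpha> (chain_norm O1 \<alpha>)))"
  have "verts G \<noteq> {}" using assms(4) by blast
  then have "?N * (\<Prod>e \<in> P. fact (c e)) = of_nat (chain_norm O1 \<alpha>) * of_nat (ec D)"
    using card_circuits[THEN arg_cong[where f = rat_of_nat]] by simp
  moreover have "(\<Prod>e \<in> P. fact (c e) :: rat) \<noteq> 0" using finite_P by simp
  ultimately have "?N = of_nat (chain_norm O1 \<alpha>) * of_nat (ec D) / (\<Prod>e \<in> P. fact (c e))"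
    by (intro eq_divide_imp)
  then have "?N = of_nat (chain_norm O1 \<alpha>) * of_nat (ec D) * (\<Prod>e \<in> P. inverse (fact (c e)))"
    by (simp add: divide_inverse prod_inversef[symmetric] comp_def)
  moreover have "rat_of_nat (ec D) = of_int (det (mat_delete (laplacian G arev O1 \<alpha> vs) k k))
      * (\<Prod>v \<in> verts G. fact (outdeg G arev O1 \<alpha> v - 1))"
    using ec_lift[OF assms(5-7), THEN arg_cong[where f = rat_of_int]] by simp
  ultimately show ?thesis by (simp add: mult.assoc)
qed

end
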